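(* For every $n\ge1$: (1) $|T_n|=|\mathcal{IS}_{n-1}|+L_{n-1}$; (2) $|\mathcal{IS}_n|=|T_n|+L^{(n)}$.
   Context: For $m\ge0$ let $\mathcal{IS}_m$ be the symmetric inverse semigroup of all partial injective maps from $\{1,\dots,m\}$ to itself (bijections between subsets $\operatorname{dom}(\alpha)$ and $\operatorname{im}(\alpha)$; the empty map, denoted $0$, is the zero element), under composition of partial maps; $\mathcal{IS}_0=\{0\}$ has one element. $T_m\subseteq\mathcal{IS}_m$ is the set of nilpotent elements, i.e. those $\alpha$ with $\alpha^r=0$ for some $r>0$. The graph of the action of $\alpha$ has an arrow $x\to\alpha(x)$ for each $x\in\operatorname{dom}(\alpha)$; each connected component is either a directed cycle or a directed path $a_1\to\dots\to a_k$, $k\ge1$, with $a_1\notin\operatorname{im}(\alpha)$, $a_k\notin\operatorname{dom}(\alpha)$ (a "chain"; a chain of length 1 is a point outside $\operatorname{dom}(\alpha)\cup\operatorname{im}(\alpha)$). $L_m$ is the total number of chains in the chain decompositions of all elements of $\mathcal{IS}_m$ (so $L_0=0$), and $L^{(m)}$ is the total number of chains in the chain decompositions of all elements of $T_m$. *)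

theory Defs
  imports Main
begin

text \<open>
  Partial maps on \<open>{1..m}\<close> are represented as \<^typ>\<open>nat \<Rightarrow> nat option\<close>
  with domain and range contained in \<open>{1..m}\<close>; the empty map
  \<^term>\<open>Map.empty\<close> is the zero element, and composition is \<open>\<circ>\<^sub>m\<close>.
\<close>

definition sym_inv_semigroup :: "nat \<Rightarrow> (nat \<Rightarrow> nat option) set" where
  "sym_inv_semigroup m =
     {\<alpha>. dom \<alpha> \<subseteq> {1..m} \<and> ran \<alpha> \<subseteq> {1..m} \<and> inj_on \<alpha> (dom \<alpha>)}"

text \<open>
  The zeroth power is the identity on the whole type rather than on \<open>{1..m}\<close>; only
  positive powers are used below, and \<open>map_power \<alpha> 1 = \<alpha>\<close>.
\<close>

primrec map_power :: "('a \<Rightarrow> 'a option) \<Rightarrow> nat \<Rightarrow> ('a \<Rightarrow> 'a option)" where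
  "map_power \<alpha> 0 = Some"
| "map_power \<alpha> (Suc r) = \<alpha> \<circ>\<^sub>m map_power \<alpha> r"

definition nilpotents :: "nat \<Rightarrow> (nat \<Rightarrow> nat option) set" where
  "nilpotents m = {\<alpha> \<in> sym_inv_semigroup m. \<exists>r>0. map_power \<alpha> r = Map.empty}"

text \<open>
  Connected components are taken in the underlying undirected graph on the vertex
  set \<open>{1..m}\<close>, so every point outside \<open>dom \<alpha> \<union> ran \<alpha>\<close> is a component by itself.
\<close>

definition action_arrow :: "('a \<Rightarrow> 'a option) \<Rightarrow> 'a \<Rightarrow> 'a \<Rightarrow> bool" where
  "action_arrow \<alpha> x y \<longleftrightarrow> \<alpha> x = Some y"

definition action_components :: "nat \<Rightarrow> (nat \<Rightarrow> nat option) \<Rightarrow> nat set set" where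
  "action_components m \<alpha> =
     {1..m} // {(x, y). x \<in> {1..m} \<and> y \<in> {1..m} \<and> equivclp (action_arrow \<alpha>) x y}"

definition is_maximal_path :: "('a \<Rightarrow> 'a option) \<Rightarrow> 'a list \<Rightarrow> bool" where
  "is_maximal_path \<alpha> xs \<longleftrightarrow>
     xs \<noteq> [] \<and> distinct xs \<and>
     (\<forall>i. Suc i < length xs \<longrightarrow> action_arrow \<alpha> (xs ! i) (xs ! Suc i)) \<and>
     hd xs \<notin> ran \<alpha> \<and> last xs \<notin> dom \<alpha>"

definition chains :: "nat \<Rightarrow> (nat \<Rightarrow> nat option) \<Rightarrow> nat set set" where
  "chains m \<alpha> = {C \<in> action_components m \<alpha>. \<exists>xs. set xs = C \<and> is_maximal_path \<alpha> xs}"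

definition total_chains :: "nat \<Rightarrow> nat" where
  "total_chains m = (\<Sum>\<alpha>\<in>sym_inv_semigroup m. card (chains m \<alpha>))"

definition total_chains_nilpotent :: "nat \<Rightarrow> nat" where
  "total_chains_nilpotent m = (\<Sum>\<alpha>\<in>nilpotents m. card (chains m \<alpha>))"

text \<open>The sets counted and summed over are finite, so no degenerate values arise.\<close>

lemma finite_sym_inv_semigroup: "finite (sym_inv_semigroup m)"
proof (rule finite_subset)
  show "sym_inv_semigroup m \<subseteq>
      (\<Union>A\<in>Pow {1..m}. {\<alpha>. dom \<alpha> = A \<and> ran \<alpha> \<subseteq> {1..m}})"
    by (auto simp: sym_inv_semigroup_def)
  show "finite (\<Union>A\<in>Pow {1..m}. {\<alpha>. dom \<alpha> = A \<and> ran \<alpha> \<subseteq> {1..m}})"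
    by (auto intro!: finite_set_of_finite_maps finite_subset[of _ "{1..m}"])
qed

lemma finite_nilpotents: "finite (nilpotents m)"
  by (simp add: nilpotents_def finite_sym_inv_semigroup)

lemma finite_chains: "finite (chains m \<alpha>)"
proof (rule finite_subset)
  show "chains m \<alpha> \<subseteq> Pow {1..m}"
    by (auto simp: chains_def action_components_def quotient_def)
qed simp

end

theory Submission
  imports Defs
begin

text \<open>
  Both identities follow from counting the maps with a prescribed domain \<open>A\<close>. Write
  \<open>p n k = n (n - 1) \<dots> (n - k + 1)\<close>. There are \<open>p n |A|\<close> partial injections of
  \<open>{1..n}\<close> with domain \<open>A\<close>, because the images can be chosen one after the other. Nilpotent
  elements are those whose graph has no directed cycle. Building them arrow by arrow, a new
  arrow that leaves \<open>x\<close> must avoid the points already hit and also the first point of the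
  chain that currently ends in \<open>x\<close>, since only that choice closes a cycle. This is one
  choice fewer at every step, so \<open>p (n - 1) |A|\<close> of these maps are nilpotent
  (\<open>card_injections_from\<close>, \<open>card_acyclic_injections_from\<close>). Finally, a chain is
  determined by its last point, and the last points of chains are exactly the points outside
  the domain, so a map with domain \<open>A\<close> has \<open>n - |A|\<close> chains (\<open>card_chains\<close>).

  For (1), split the sum of \<open>p (n - 1) |A|\<close> over all \<open>A \<subseteq> {1..n}\<close> according to whether
  \<open>n \<in> A\<close>. The sets without \<open>n\<close> contribute \<open>|IS|\<close> for \<open>n - 1\<close> points. The sets
  \<open>A \<union> {n}\<close> with \<open>n \<notin> A\<close> contribute \<open>p (n - 1) (|A| + 1) = p (n - 1) |A| (n - 1 - |A|)\<close> each, which is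
  the number of maps with domain \<open>A\<close> weighted by their number of chains.

  For (2), use \<open>p n k = p (n - 1) k + k p (n - 1) (k - 1)\<close>. The first term sums to the number
  of nilpotent elements. In the second, the factor \<open>k = |A|\<close> chooses a point of \<open>A\<close> to
  delete; counting instead by the smaller set \<open>B\<close> and the point to add gives
  \<open>p (n - 1) |B| (n - |B|)\<close>, the chains of the nilpotent elements with domain \<open>B\<close>
  (\<open>sum_Pow_delete_point\<close>).
\<close>

section \<open>Falling factorials\<close>

text \<open>
  The product \<open>n (n - 1) \<dots> (n - k + 1)\<close>. The form with a binomial coefficient turns
  Pascal's rule into the recurrence in \<open>n\<close> that separates nilpotent maps from the others.
\<close>

definition falling_factorial :: "nat \<Rightarrow> nat \<Rightarrow> nat" where
  "falling_factorial n k = fact k * (n choose k)"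

lemma falling_factorial_0 [simp]: "falling_factorial n 0 = 1"
  by (simp add: falling_factorial_def)

lemma falling_factorial_Suc: "falling_factorial n (Suc k) = falling_factorial n k * (n - k)"
proof -
  have "falling_factorial n (Suc k) = fact k * (Suc k * (n choose Suc k))"
    by (simp add: falling_factorial_def algebra_simps)
  also have "Suc k * (n choose Suc k) = (n - k) * (n choose k)"
    by (simp only: binomial_absorption binomial_absorb_comp)
  finally show ?thesis by (simp add: falling_factorial_def)
qed

lemma falling_factorial_Pascal:
  "falling_factorial (Suc n) k = falling_factorial n k + k * falling_factorial n (k - 1)"
  by (cases k) (simp_all add: falling_factorial_def algebra_simps)

section \<open>Maximal paths\<close>

lemma nth_without_successor:
  assumes "i < length xs" "\<not> Suc i < length xs"
  shows "xs ! i = last xs"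
proof -
  have "i = length xs - 1" "xs \<noteq> []" using assms by auto
  then show ?thesis by (simp add: last_conv_nth)
qed

text \<open>
  A longest path that ends in \<open>x\<close> cannot be prolonged at its start. A predecessor of its
  first point would be a new point: the last point \<open>x\<close> has no outgoing arrow, and the arrow
  of every other point of the path leads to a point after the first.
\<close>

lemma maximal_path_ending_at:
  assumes fin: "finite (dom \<alpha>)" and inj: "inj_on \<alpha> (dom \<alpha>)" and x: "x \<notin> dom \<alpha>"
  obtains xs where "is_maximal_path \<alpha> xs" "last xs = x"
proof -
  define P where "P xs \<longleftrightarrow> xs \<noteq> [] \<and> distinct xs \<and> last xs = x \<and>
    (\<forall>i. Suc i < length xs \<longrightarrow> \<alpha> (xs ! i) = Some (xs ! Suc i))" for xs
  have inner: "xs ! i \<in> dom \<alpha>" if "P xs" "Suc i < length xs" for xs i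
    using that by (auto simp: P_def)
  have sub: "set xs \<subseteq> insert x (dom \<alpha>)" if "P xs" for xs
  proof
    fix u assume "u \<in> set xs"
    then obtain i where i: "i < length xs" "u = xs ! i" by (auto simp: in_set_conv_nth)
    show "u \<in> insert x (dom \<alpha>)"
    proof (cases "Suc i < length xs")
      case True
      then show ?thesis using inner[OF that] i by blast
    next
      case False
      then have "u = last xs" using i nth_without_successor by metis
      then show ?thesis using that by (simp add: P_def)
    qed
  qed
  have bound: "length xs \<le> card (insert x (dom \<alpha>))" if "P xs" for xs
    using card_mono[OF _ sub[OF that]] fin that by (simp add: P_def distinct_card)
  have "P [x]" by (simp add: P_def)
  then obtain xs where xs: "P xs" and longest: "\<And>ys. P ys \<Longrightarrow> length ys \<le> length xs"
    using ex_has_greatest_nat[of P "[x]" length "Suc (card (insert x (dom \<alpha>)))"] bound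
    by (metis less_Suc_eq_le)
  have "hd xs \<notin> ran \<alpha>"
  proof
    assume "hd xs \<in> ran \<alpha>"
    then obtain y where y: "\<alpha> y = Some (hd xs)" by (auto simp: ran_def)
    have "y \<notin> set xs"
    proof
      assume "y \<in> set xs"
      then obtain i where i: "i < length xs" "y = xs ! i" by (auto simp: in_set_conv_nth)
      have "Suc i < length xs"
      proof (rule ccontr)
        assume "\<not> Suc i < length xs"
        then have "y = x" using i xs nth_without_successor[of i xs] by (simp add: P_def)
        then show False using x y by auto
      qed
      then have "xs ! Suc i = xs ! 0"
        using y i xs by (simp add: P_def hd_conv_nth)
      then show False
        using xs \<open>Suc i < length xs\<close> by (simp add: P_def nth_eq_iff_index_eq)
    qed
    then have "P (y # xs)"
      using xs y by (auto simp: P_def hd_conv_nth nth_Cons split: nat.split)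
    then show False using longest by force
  qed
  then have "is_maximal_path \<alpha> xs" "last xs = x"
    using xs x by (auto simp: P_def is_maximal_path_def action_arrow_def)
  then show thesis by (rule that)
qed

lemma maximal_path_start:
  assumes "is_maximal_path \<alpha> xs" "u \<in> set xs"
  shows "u \<notin> ran \<alpha> \<longleftrightarrow> u = hd xs"
proof
  assume "u \<notin> ran \<alpha>"
  from assms(2) obtain i where i: "i < length xs" "u = xs ! i" by (auto simp: in_set_conv_nth)
  show "u = hd xs"
  proof (cases i)
    case 0
    then show ?thesis using i assms(1) by (simp add: is_maximal_path_def hd_conv_nth)
  next
    case (Suc j)
    then have "\<alpha> (xs ! j) = Some u"
      using i assms(1) by (simp add: is_maximal_path_def action_arrow_def)
    then show ?thesis using \<open>u \<notin> ran \<alpha>\<close> by (auto intro: ranI)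
  qed
qed (use assms in \<open>simp add: is_maximal_path_def\<close>)

lemma maximal_path_end:
  assumes "is_maximal_path \<alpha> xs" "u \<in> set xs"
  shows "u \<notin> dom \<alpha> \<longleftrightarrow> u = last xs"
proof
  assume "u \<notin> dom \<alpha>"
  from assms(2) obtain i where i: "i < length xs" "u = xs ! i" by (auto simp: in_set_conv_nth)
  have "\<not> Suc i < length xs"
    using i assms(1) \<open>u \<notin> dom \<alpha>\<close> by (auto simp: is_maximal_path_def action_arrow_def)
  then show "u = last xs" using i nth_without_successor by metis
qed (use assms in \<open>simp add: is_maximal_path_def\<close>)

lemma maximal_path_closed_forward:
  assumes "is_maximal_path \<alpha> xs" "u \<in> set xs" "\<alpha> u = Some w"
  shows "w \<in> set xs"
proof -
  from assms(2) obtain i where i: "i < length xs" "u = xs ! i" by (auto simp: in_set_conv_nth)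
  have "u \<noteq> last xs" using maximal_path_end[OF assms(1,2)] assms(3) by auto
  then have "Suc i < length xs"
    using i nth_without_successor by metis
  then have "w = xs ! Suc i"
    using i assms by (auto simp: is_maximal_path_def action_arrow_def)
  then show ?thesis using \<open>Suc i < length xs\<close> by simp
qed

lemma maximal_path_closed_backward:
  assumes "is_maximal_path \<alpha> xs" "inj_on \<alpha> (dom \<alpha>)" "u \<in> set xs" "\<alpha> w = Some u"
  shows "w \<in> set xs"
proof -
  from assms(3) obtain i where i: "i < length xs" "u = xs ! i" by (auto simp: in_set_conv_nth)
  have "u \<noteq> hd xs" using maximal_path_start[OF assms(1,3)] assms(4) by (auto intro: ranI)
  then obtain j where j: "i = Suc j"
    using i assms(1) by (cases i) (auto simp: hd_conv_nth is_maximal_path_def)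
  have "\<alpha> (xs ! j) = Some u"
    using i j assms(1) by (simp add: is_maximal_path_def action_arrow_def)
  then have "w = xs ! j"
    using assms(2,4) by (auto dest!: inj_onD[of \<alpha> "dom \<alpha>" w "xs ! j"])
  then show ?thesis using i j by simp
qed

text \<open>
  Injectivity makes the predecessor of a point unique, so going back from the last point
  never leaves the path. In combination with \<open>maximal_path_start\<close>, the only point outside
  the range from which \<open>last xs\<close> can be reached is \<open>hd xs\<close>.
\<close>

lemma maximal_path_eq_ancestors:
  assumes path: "is_maximal_path \<alpha> xs" and inj: "inj_on \<alpha> (dom \<alpha>)"
  shows "u \<in> set xs \<longleftrightarrow> (u, last xs) \<in> (Map.graph \<alpha>)\<^sup>*"
proof
  assume "u \<in> set xs"
  then obtain i where i: "i < length xs" "u = xs ! i" by (auto simp: in_set_conv_nth)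
  have "i \<le> length xs - 1" using i by simp
  then have "(xs ! i, last xs) \<in> (Map.graph \<alpha>)\<^sup>*"
  proof (induction i rule: inc_induct)
    case base
    then show ?case using path by (simp add: is_maximal_path_def last_conv_nth)
  next
    case (step j)
    then have "(xs ! j, xs ! Suc j) \<in> Map.graph \<alpha>"
      using path by (simp add: is_maximal_path_def action_arrow_def in_graphI)
    then show ?case using step by (meson converse_rtrancl_into_rtrancl)
  qed
  then show "(u, last xs) \<in> (Map.graph \<alpha>)\<^sup>*" using i by simp
next
  assume "(u, last xs) \<in> (Map.graph \<alpha>)\<^sup>*"
  then show "u \<in> set xs"
  proof (induction rule: converse_rtrancl_induct)
    case base
    then show ?case using path by (simp add: is_maximal_path_def)
  next
    case (step y z)
    then show ?case
      using maximal_path_closed_backward[OF path inj] by (auto dest: in_graphD)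
  qed
qed

text \<open>
  The path is closed under arrows in both directions, hence it fills its component.
\<close>

lemma maximal_path_eq_component:
  assumes path: "is_maximal_path \<alpha> xs" and inj: "inj_on \<alpha> (dom \<alpha>)"
  shows "u \<in> set xs \<longleftrightarrow> equivclp (action_arrow \<alpha>) (last xs) u"
proof
  assume "u \<in> set xs"
  then have "(u, last xs) \<in> (Map.graph \<alpha>)\<^sup>*"
    by (simp add: maximal_path_eq_ancestors[OF path inj])
  then have "equivclp (action_arrow \<alpha>) u (last xs)"
  proof (induction rule: rtrancl_induct)
    case base
    show ?case by simp
  next
    case (step y z)
    then have "action_arrow \<alpha> y z" by (auto simp: action_arrow_def dest: in_graphD)
    then show ?case using step.IH by (meson equivclp_trans r_into_equivclp)
  qed
  then show "equivclp (action_arrow \<alpha>) (last xs) u" by (rule equivclp_sym)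
next
  assume "equivclp (action_arrow \<alpha>) (last xs) u"
  then show "u \<in> set xs"
  proof (induction rule: equivclp_induct)
    case base
    then show ?case using path by (simp add: is_maximal_path_def)
  next
    case (step y z)
    from step.hyps(2) show ?case
      unfolding action_arrow_def
      using maximal_path_closed_backward[OF path inj step.IH]
        maximal_path_closed_forward[OF path step.IH] by blast
  qed
qed

section \<open>Counting chains\<close>

text \<open>
  Sending a point outside the domain to its component is a bijection onto the chains; the
  inverse sends a chain to its last point.
\<close>

lemma card_chains:
  assumes "\<alpha> \<in> sym_inv_semigroup m"
  shows "card (chains m \<alpha>) = m - card (dom \<alpha>)"
proof -
  let ?r = "{(x, y). x \<in> {1..m} \<and> y \<in> {1..m} \<and> equivclp (action_arrow \<alpha>) x y}"
  have dom: "dom \<alpha> \<subseteq> {1..m}" and inj: "inj_on \<alpha> (dom \<alpha>)"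
    using assms by (auto simp: sym_inv_semigroup_def)
  have fin: "finite (dom \<alpha>)" using dom finite_subset by blast
  have equiv: "equiv {1..m} ?r"
    by (auto simp: equiv_def refl_on_def sym_on_def trans_on_def
        intro: equivclp_sym equivclp_trans)
  have cls: "?r `` {last xs} = set xs"
    if path: "is_maximal_path \<alpha> xs" and last: "last xs \<in> {1..m}" for xs
  proof -
    have "set xs \<subseteq> {1..m}"
      using maximal_path_end[OF path] last dom by blast
    then show ?thesis
      using last by (auto simp: maximal_path_eq_component[OF path inj])
  qed
  have "bij_betw (\<lambda>e. ?r `` {e}) ({1..m} - dom \<alpha>) (chains m \<alpha>)"
    unfolding bij_betw_def
  proof
    show "inj_on (\<lambda>e. ?r `` {e}) ({1..m} - dom \<alpha>)"
    proof (rule inj_onI)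
      fix e f assume e: "e \<in> {1..m} - dom \<alpha>" and f: "f \<in> {1..m} - dom \<alpha>"
        and eq: "?r `` {e} = ?r `` {f}"
      obtain xs where xs: "is_maximal_path \<alpha> xs" "last xs = e"
        using maximal_path_ending_at[OF fin inj] e by blast
      have "f \<in> ?r `` {f}" using f by simp
      then have "f \<in> set xs" using eq cls[OF xs(1)] xs(2) e by simp
      then show "e = f" using maximal_path_end[OF xs(1)] xs(2) f by auto
    qed
    show "(\<lambda>e. ?r `` {e}) ` ({1..m} - dom \<alpha>) = chains m \<alpha>"
    proof (intro equalityI subsetI)
      fix C assume "C \<in> (\<lambda>e. ?r `` {e}) ` ({1..m} - dom \<alpha>)"
      then obtain e where e: "e \<in> {1..m} - dom \<alpha>" "C = ?r `` {e}" by blast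
      obtain xs where xs: "is_maximal_path \<alpha> xs" "last xs = e"
        using maximal_path_ending_at[OF fin inj] e by blast
      have "C \<in> {1..m} // ?r" unfolding e(2) by (rule quotientI) (use e in simp)
      moreover have "set xs = C" using cls[OF xs(1)] xs(2) e by simp
      ultimately show "C \<in> chains m \<alpha>"
        using xs(1) unfolding chains_def action_components_def by blast
    next
      fix C assume "C \<in> chains m \<alpha>"
      then obtain xs where C: "C \<in> {1..m} // ?r" "set xs = C" and xs: "is_maximal_path \<alpha> xs"
        unfolding chains_def action_components_def by blast
      have "C \<subseteq> {1..m}" using C(1) by (auto simp: quotient_def)
      moreover have "last xs \<in> C" "last xs \<notin> dom \<alpha>"
        using xs C(2) by (auto simp: is_maximal_path_def)
      ultimately have last: "last xs \<in> {1..m} - dom \<alpha>" by blast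
      then have "C = ?r `` {last xs}" using cls[OF xs] C(2) by simp
      then show "C \<in> (\<lambda>e. ?r `` {e}) ` ({1..m} - dom \<alpha>)" using last by blast
    qed
  qed
  then have "card (chains m \<alpha>) = card ({1..m} - dom \<alpha>)"
    by (simp add: bij_betw_same_card)
  then show ?thesis using dom fin by (simp add: card_Diff_subset)
qed

section \<open>Nilpotent elements\<close>

lemma map_power_eq_Some_iff: "map_power \<alpha> r x = Some y \<longleftrightarrow> (x, y) \<in> Map.graph \<alpha> ^^ r"
proof (induction r arbitrary: y)
  case (Suc r)
  show ?case
    by (auto simp: map_comp_Some_iff Suc.IH relcomp_unfold intro: in_graphI dest: in_graphD)
qed auto

text \<open>
  The arrows of \<open>\<alpha>\<^sup>r\<close> are the walks of length \<open>r\<close> in the graph of \<open>\<alpha>\<close>. A cycle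
  provides walks of every length, whereas walks in a finite acyclic graph have bounded length.
\<close>

lemma nilpotent_iff_acyclic:
  assumes fin: "finite (dom \<alpha>)"
  shows "(\<exists>r>0. map_power \<alpha> r = Map.empty) \<longleftrightarrow> acyclic (Map.graph \<alpha>)"
proof
  assume "\<exists>r>0. map_power \<alpha> r = Map.empty"
  then obtain r where r: "r > 0" "map_power \<alpha> r = Map.empty" by blast
  have "(x, x) \<notin> (Map.graph \<alpha>)\<^sup>+" for x
  proof
    assume "(x, x) \<in> (Map.graph \<alpha>)\<^sup>+"
    then obtain k where k: "k > 0" "(x, x) \<in> Map.graph \<alpha> ^^ k" by (auto simp: trancl_power)
    \<comment> \<open>Running around the cycle \<open>r\<close> times gives a walk of length at least \<open>r\<close>,
      which contains a walk of length exactly \<open>r\<close>.\<close>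
    have loops: "(x, x) \<in> Map.graph \<alpha> ^^ (j * k)" for j
    proof (induction j)
      case (Suc j)
      show ?case unfolding mult_Suc relpow_add using k(2) Suc.IH by (rule relcompI)
    qed simp
    have "r * k = r + r * (k - 1)" using k(1) by (cases k) simp_all
    then have "(x, x) \<in> Map.graph \<alpha> ^^ r O Map.graph \<alpha> ^^ (r * (k - 1))"
      using loops[of r] by (simp only: relpow_add)
    moreover have "Map.graph \<alpha> ^^ r = {}"
      using r(2) map_power_eq_Some_iff[of \<alpha> r] by auto
    ultimately show False by simp
  qed
  then show "acyclic (Map.graph \<alpha>)" by (simp add: acyclic_def)
next
  assume acyc: "acyclic (Map.graph \<alpha>)"
  \<comment> \<open>The number of points strictly below a point drops along every arrow,
    which bounds the length of all paths.\<close>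
  define below where "below x = {y. (x, y) \<in> (Map.graph \<alpha>)\<^sup>+}" for x
  have "finite (ran \<alpha>)" using fin by (rule finite_ran)
  have below_ran: "below x \<subseteq> ran \<alpha>" for x
    by (auto simp: below_def dest!: tranclD2 in_graphD intro: ranI)
  have decrease: "card (below y) < card (below x)" if "(x, y) \<in> Map.graph \<alpha>" for x y
  proof (rule psubset_card_mono)
    show "finite (below x)" using below_ran \<open>finite (ran \<alpha>)\<close> finite_subset by blast
    have "below y \<subseteq> below x" using that by (auto simp: below_def intro: trancl_into_trancl2)
    moreover have "y \<in> below x" using that by (auto simp: below_def)
    moreover have "y \<notin> below y" using acyc by (simp add: below_def acyclic_def)
    ultimately show "below y \<subset> below x" by blast
  qed
  have long: "r + card (below y) \<le> card (below x)" if "(x, y) \<in> Map.graph \<alpha> ^^ r" for r x y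
    using that
  proof (induction r arbitrary: y)
    case (Suc r)
    then show ?case using decrease by fastforce
  qed simp
  have "map_power \<alpha> (Suc (card (ran \<alpha>))) x = None" for x
  proof (rule ccontr)
    assume "map_power \<alpha> (Suc (card (ran \<alpha>))) x \<noteq> None"
    then obtain y where "(x, y) \<in> Map.graph \<alpha> ^^ Suc (card (ran \<alpha>))"
      unfolding map_power_eq_Some_iff[symmetric] by blast
    from long[OF this] have "card (ran \<alpha>) < card (below x)" by simp
    then show False using card_mono[OF \<open>finite (ran \<alpha>)\<close> below_ran[of x]] by simp
  qed
  then show "\<exists>r>0. map_power \<alpha> r = Map.empty" by blast
qed

section \<open>Partial injections with a given domain\<close>

definition injections_from :: "'a set \<Rightarrow> 'a set \<Rightarrow> ('a \<Rightarrow> 'a option) set" where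
  "injections_from V A = {\<alpha>. dom \<alpha> = A \<and> ran \<alpha> \<subseteq> V \<and> inj_on \<alpha> (dom \<alpha>)}"

definition acyclic_injections_from :: "'a set \<Rightarrow> 'a set \<Rightarrow> ('a \<Rightarrow> 'a option) set" where
  "acyclic_injections_from V A = {\<alpha> \<in> injections_from V A. acyclic (Map.graph \<alpha>)}"

lemma card_ran_eq_card_dom:
  assumes "inj_on \<alpha> (dom \<alpha>)"
  shows "card (ran \<alpha>) = card (dom \<alpha>)"
proof -
  have "card (Some ` ran \<alpha>) = card (\<alpha> ` dom \<alpha>)"
    by (rule arg_cong[where f = card]) (force simp: ran_def dom_def)
  then show ?thesis using assms by (simp add: card_image)
qed

lemma finite_injections_from:
  assumes "finite V" "finite A"
  shows "finite (injections_from V A)"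
  by (rule finite_subset[OF _ finite_set_of_finite_maps[OF assms(2,1)]])
    (auto simp: injections_from_def)

text \<open>
  The induction step common to both counts below: the maps in \<open>F'\<close> arise from those in
  \<open>F\<close> by an additional arrow out of \<open>x\<close>, and the number of admissible targets is the same
  for every map in \<open>F\<close>. The old map and the target can be read off from the result.
\<close>

lemma card_one_arrow_extensions:
  assumes "finite F" "\<And>\<beta>. \<beta> \<in> F \<Longrightarrow> x \<notin> dom \<beta>"
    and "\<And>\<beta>. \<beta> \<in> F \<Longrightarrow> finite (C \<beta>)" "\<And>\<beta>. \<beta> \<in> F \<Longrightarrow> card (C \<beta>) = c"
    and ext: "\<And>\<alpha>. \<alpha> \<in> F' \<longleftrightarrow> (\<exists>\<beta>\<in>F. \<exists>y\<in>C \<beta>. \<alpha> = \<beta>(x \<mapsto> y))"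
  shows "card F' = card F * c"
proof -
  have eq: "F' = (\<lambda>(\<beta>, y). \<beta>(x \<mapsto> y)) ` Sigma F C" using ext by (auto simp: image_iff)
  have "inj_on (\<lambda>(\<beta>, y). \<beta>(x \<mapsto> y)) (Sigma F C)"
  proof (rule inj_onI, clarify)
    fix \<beta> y \<gamma> z assume "\<beta> \<in> F" "\<gamma> \<in> F" and eq: "\<beta>(x \<mapsto> y) = \<gamma>(x \<mapsto> z)"
    then have none: "\<beta> x = None" "\<gamma> x = None" using assms(2) by blast+
    have "\<beta> u = \<gamma> u" for u using fun_cong[OF eq, of u] none by (cases "u = x") auto
    moreover have "y = z" using fun_cong[OF eq, of x] by simp
    ultimately show "\<beta> = \<gamma> \<and> y = z" by blast
  qed
  then show ?thesis unfolding eq using assms(1,3,4) by (simp add: card_image)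
qed

lemma injections_from_insert_iff:
  assumes "x \<notin> A"
  shows "\<alpha> \<in> injections_from V (insert x A) \<longleftrightarrow>
    (\<exists>\<beta>\<in>injections_from V A. \<exists>y\<in>V - ran \<beta>. \<alpha> = \<beta>(x \<mapsto> y))"
proof
  assume \<alpha>: "\<alpha> \<in> injections_from V (insert x A)"
  then obtain y where y: "\<alpha> x = Some y" by (auto simp: injections_from_def)
  define \<beta> where "\<beta> = \<alpha>(x := None)"
  have "y \<notin> ran \<beta>"
  proof
    assume "y \<in> ran \<beta>"
    then obtain u where "u \<noteq> x" "\<alpha> u = Some y"
      by (auto simp: ran_def \<beta>_def split: if_splits)
    then show False using \<alpha> y by (auto simp: injections_from_def dest: inj_onD[of \<alpha> _ u x])
  qed
  moreover have "y \<in> V" using \<alpha> y by (auto simp: injections_from_def intro: ranI)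
  moreover have "\<beta> \<in> injections_from V A"
    using \<alpha> assms by (auto simp: injections_from_def \<beta>_def ran_def inj_on_def)
  moreover have "\<alpha> = \<beta>(x \<mapsto> y)" using y by (auto simp: \<beta>_def)
  ultimately show "\<exists>\<beta>\<in>injections_from V A. \<exists>y\<in>V - ran \<beta>. \<alpha> = \<beta>(x \<mapsto> y)" by blast
next
  assume "\<exists>\<beta>\<in>injections_from V A. \<exists>y\<in>V - ran \<beta>. \<alpha> = \<beta>(x \<mapsto> y)"
  then obtain \<beta> y where \<beta>: "\<beta> \<in> injections_from V A" "y \<in> V" "y \<notin> ran \<beta>"
    and \<alpha>: "\<alpha> = \<beta>(x \<mapsto> y)" by blast
  have "\<beta> x = None" using \<beta> assms by (auto simp: injections_from_def)
  then show "\<alpha> \<in> injections_from V (insert x A)"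
    using \<beta> unfolding \<alpha> by (auto simp: injections_from_def inj_on_def ran_def)
qed

text \<open>
  The arrow from \<open>x\<close> to \<open>y\<close> closes a cycle exactly if \<open>x\<close> can already be reached
  from \<open>y\<close>.
\<close>

lemma acyclic_injections_from_insert_iff:
  assumes "x \<notin> A"
  shows "\<alpha> \<in> acyclic_injections_from V (insert x A) \<longleftrightarrow>
    (\<exists>\<beta>\<in>acyclic_injections_from V A.
      \<exists>y\<in>V - ran \<beta> - {y. (y, x) \<in> (Map.graph \<beta>)\<^sup>*}. \<alpha> = \<beta>(x \<mapsto> y))"
proof -
  have "acyclic (Map.graph (\<beta>(x \<mapsto> y))) \<longleftrightarrow>
      acyclic (Map.graph \<beta>) \<and> (y, x) \<notin> (Map.graph \<beta>)\<^sup>*"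
    if "\<beta> \<in> injections_from V A" for \<beta> y
  proof -
    have "\<beta>(x := None) = \<beta>" using that assms by (auto simp: injections_from_def)
    then show ?thesis by (simp add: graph_map_upd acyclic_insert)
  qed
  then show ?thesis
    unfolding acyclic_injections_from_def mem_Collect_eq
      injections_from_insert_iff[OF assms, of \<alpha> V] by blast
qed

lemma card_injections_from:
  assumes "finite V" "A \<subseteq> V"
  shows "card (injections_from V A) = falling_factorial (card V) (card A)"
  using finite_subset[OF assms(2,1)] assms(2)
proof (induction A rule: finite_induct)
  case empty
  have "injections_from V {} = {Map.empty}" by (auto simp: injections_from_def)
  then show ?case by simp
next
  case (insert x A)
  have "card (injections_from V (insert x A)) = card (injections_from V A) * (card V - card A)"
  proof (rule card_one_arrow_extensions[OF _ _ _ _ injections_from_insert_iff[OF insert.hyps(2)]])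
    fix \<beta> assume \<beta>: "\<beta> \<in> injections_from V A"
    then show "x \<notin> dom \<beta>" using insert.hyps(2) by (simp add: injections_from_def)
    have "ran \<beta> \<subseteq> V" "card (ran \<beta>) = card A"
      using \<beta> card_ran_eq_card_dom[of \<beta>] by (auto simp: injections_from_def)
    then show "card (V - ran \<beta>) = card V - card A"
      using assms(1) by (simp add: card_Diff_subset finite_subset)
  qed (use assms(1) insert.hyps in \<open>auto intro: finite_injections_from\<close>)
  also have "\<dots> = falling_factorial (card V) (card (insert x A))"
    using insert by (simp add: falling_factorial_Suc)
  finally show ?case .
qed

text \<open>
  Since \<open>x\<close> is not yet in the domain, a chain ends in \<open>x\<close>. Among the points outside the
  range, its first point is the only one from which \<open>x\<close> can be reached, so precisely one of
  the targets that injectivity permits is excluded.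
\<close>

lemma card_acyclic_injections_from:
  assumes "finite V" "A \<subseteq> V" "V \<noteq> {}"
  shows "card (acyclic_injections_from V A) =
    falling_factorial (card V - 1) (card A)"
  using finite_subset[OF assms(2,1)] assms(2)
proof (induction A rule: finite_induct)
  case empty
  have "acyclic_injections_from V {} = {Map.empty}"
    by (auto simp: acyclic_injections_from_def injections_from_def acyclic_def)
  then show ?case by simp
next
  case (insert x A)
  have "card (acyclic_injections_from V (insert x A)) =
    card (acyclic_injections_from V A) * (card V - 1 - card A)"
  proof (rule card_one_arrow_extensions[OF _ _ _ _
        acyclic_injections_from_insert_iff[OF insert.hyps(2)]])
    show "finite (acyclic_injections_from V A)"
      using finite_injections_from[OF assms(1) insert.hyps(1)]
      by (simp add: acyclic_injections_from_def)
    fix \<beta> assume "\<beta> \<in> acyclic_injections_from V A"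
    then have dom: "dom \<beta> = A" and ran: "ran \<beta> \<subseteq> V" and inj: "inj_on \<beta> (dom \<beta>)"
      by (auto simp: acyclic_injections_from_def injections_from_def)
    show x: "x \<notin> dom \<beta>" using insert.hyps(2) dom by simp
    obtain xs where xs: "is_maximal_path \<beta> xs" "last xs = x"
      using maximal_path_ending_at[OF _ inj x] insert.hyps(1) dom by blast
    have start: "hd xs \<in> set xs" using xs(1) by (simp add: is_maximal_path_def)
    have "hd xs \<in> insert x A" using maximal_path_end[OF xs(1) start] xs(2) dom by blast
    then have V: "hd xs \<in> V - ran \<beta>"
      using insert.prems maximal_path_start[OF xs(1) start] by blast
    \<comment> \<open>The excluded targets reduce to the first point of the chain that ends in \<open>x\<close>.\<close>
    have "V - ran \<beta> - {y. (y, x) \<in> (Map.graph \<beta>)\<^sup>*} = V - ran \<beta> - {hd xs}"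
      using maximal_path_eq_ancestors[OF xs(1) inj] xs(2) start
        maximal_path_start[OF xs(1)] by auto
    moreover have "card (V - ran \<beta>) = card V - card A"
      using assms(1) ran card_ran_eq_card_dom[OF inj] dom
      by (simp add: card_Diff_subset finite_subset)
    ultimately show "card (V - ran \<beta> - {y. (y, x) \<in> (Map.graph \<beta>)\<^sup>*}) = card V - 1 - card A"
      using V by simp
  qed (use assms(1) in auto)
  also have "\<dots> = falling_factorial (card V - 1) (card (insert x A))"
    using insert by (simp add: falling_factorial_Suc)
  finally show ?case .
qed

section \<open>Summing over domains\<close>

lemma sum_by_domain:
  fixes g :: "nat \<Rightarrow> nat"
  assumes "finite S" "finite V" "\<And>\<alpha>. \<alpha> \<in> S \<Longrightarrow> dom \<alpha> \<subseteq> V"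
  shows "(\<Sum>\<alpha>\<in>S. g (card (dom \<alpha>))) =
    (\<Sum>A\<in>Pow V. card {\<alpha> \<in> S. dom \<alpha> = A} * g (card A))"
proof -
  have "(\<Sum>\<alpha>\<in>S. g (card (dom \<alpha>))) =
      (\<Sum>A\<in>Pow V. \<Sum>\<alpha>\<in>{\<alpha> \<in> S. dom \<alpha> = A}. g (card (dom \<alpha>)))"
    using assms by (intro sum.group[symmetric]) auto
  also have "\<dots> = (\<Sum>A\<in>Pow V. card {\<alpha> \<in> S. dom \<alpha> = A} * g (card A))"
    by (intro sum.cong) auto
  finally show ?thesis .
qed

lemma sum_sym_inv_semigroup_by_rank:
  fixes g :: "nat \<Rightarrow> nat"
  shows "(\<Sum>\<alpha>\<in>sym_inv_semigroup m. g (card (dom \<alpha>))) =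
    (\<Sum>A\<in>Pow {1..m}. falling_factorial m (card A) * g (card A))"
proof -
  have "{\<alpha> \<in> sym_inv_semigroup m. dom \<alpha> = A} = injections_from {1..m} A"
    if "A \<subseteq> {1..m}" for A
    using that by (auto simp: sym_inv_semigroup_def injections_from_def)
  then show ?thesis
    by (subst sum_by_domain[OF finite_sym_inv_semigroup, of "{1..m}"])
      (auto simp: sym_inv_semigroup_def card_injections_from intro!: sum.cong)
qed

lemma sum_nilpotents_by_rank:
  fixes g :: "nat \<Rightarrow> nat"
  assumes "m \<ge> 1"
  shows "(\<Sum>\<alpha>\<in>nilpotents m. g (card (dom \<alpha>))) =
    (\<Sum>A\<in>Pow {1..m}. falling_factorial (m - 1) (card A) * g (card A))"
proof -
  have "{\<alpha> \<in> nilpotents m. dom \<alpha> = A} = acyclic_injections_from {1..m} A"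
    if "A \<subseteq> {1..m}" for A
  proof -
    have "finite A" using that finite_subset by blast
    then have "dom \<alpha> = A \<Longrightarrow>
        (\<exists>r>0. map_power \<alpha> r = Map.empty) \<longleftrightarrow> acyclic (Map.graph \<alpha>)" for \<alpha>
      using nilpotent_iff_acyclic by blast
    then show ?thesis
      using that unfolding nilpotents_def sym_inv_semigroup_def injections_from_def
        acyclic_injections_from_def by blast
  qed
  then show ?thesis
    using assms
    by (subst sum_by_domain[OF finite_nilpotents, of "{1..m}"])
      (auto simp: nilpotents_def sym_inv_semigroup_def card_acyclic_injections_from
        intro!: sum.cong)
qed

text \<open>
  Both sides sum \<open>g |B|\<close> over the pairs of a set \<open>B\<close> and a point of \<open>V\<close> outside \<open>B\<close>; on
  the left, the pair is recorded by the set \<open>A\<close> that consists of \<open>B\<close> and the point.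
\<close>

lemma sum_Pow_delete_point:
  fixes g :: "nat \<Rightarrow> nat"
  assumes "finite V"
  shows "(\<Sum>A\<in>Pow V. card A * g (card A - 1)) = (\<Sum>B\<in>Pow V. (card V - card B) * g (card B))"
proof -
  have fin: "finite A" if "A \<in> Pow V" for A using that assms finite_subset by blast
  have "(\<Sum>A\<in>Pow V. card A * g (card A - 1)) = (\<Sum>A\<in>Pow V. \<Sum>x\<in>A. g (card A - 1))" by simp
  also have "\<dots> = (\<Sum>(A, x)\<in>Sigma (Pow V) (\<lambda>A. A). g (card A - 1))"
    using assms fin by (intro sum.Sigma) auto
  also have "\<dots> = (\<Sum>(B, x)\<in>Sigma (Pow V) (\<lambda>B. V - B). g (card B))"
    by (rule sum.reindex_bij_witness[where i = "\<lambda>(B, x). (insert x B, x)"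
          and j = "\<lambda>(A, x). (A - {x}, x)"]) (auto simp: insert_absorb)
  also have "\<dots> = (\<Sum>B\<in>Pow V. \<Sum>x\<in>V - B. g (card B))"
    using assms by (intro sum.Sigma[symmetric]) auto
  also have "\<dots> = (\<Sum>B\<in>Pow V. (card V - card B) * g (card B))"
    using fin by (intro sum.cong) (auto simp: card_Diff_subset)
  finally show ?thesis .
qed

section \<open>The two identities\<close>

theorem theorem7:
  fixes n :: nat
  assumes "n \<ge> 1"
  shows "card (nilpotents n) = card (sym_inv_semigroup (n - 1)) + total_chains (n - 1) \<and>
      card (sym_inv_semigroup n) = card (nilpotents n) + total_chains_nilpotent n"
proof -
  obtain m where n: "n = Suc m" using assms by (cases n) auto
  have total: "total_chains k =
      (\<Sum>A\<in>Pow {1..k}. falling_factorial k (card A) * (k - card A))" for k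
    unfolding total_chains_def
    using sum_sym_inv_semigroup_by_rank[of "\<lambda>r. k - r" k] by (simp add: card_chains)
  have total_nil: "total_chains_nilpotent n =
      (\<Sum>A\<in>Pow {1..n}. falling_factorial m (card A) * (n - card A))"
    unfolding total_chains_nilpotent_def
    using sum_nilpotents_by_rank[of n "\<lambda>r. n - r"] n
    by (simp add: card_chains nilpotents_def)
  have inv: "card (sym_inv_semigroup k) = (\<Sum>A\<in>Pow {1..k}. falling_factorial k (card A))" for k
    using sum_sym_inv_semigroup_by_rank[of "\<lambda>_. 1" k] by simp
  have nil: "card (nilpotents n) = (\<Sum>A\<in>Pow {1..n}. falling_factorial m (card A))"
    using sum_nilpotents_by_rank[of n "\<lambda>_. 1"] n by simp

  \<comment> \<open>(1): separate the domains that contain \<open>n\<close> from those that do not.\<close>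
  have "card (nilpotents n) =
      (\<Sum>A\<in>Pow {1..m}. falling_factorial m (card A)) +
      (\<Sum>A\<in>insert n ` Pow {1..m}. falling_factorial m (card A))"
  proof -
    have "Pow {1..n} = Pow {1..m} \<union> insert n ` Pow {1..m}"
      by (simp add: n atLeastAtMostSuc_conv Pow_insert)
    then show ?thesis unfolding nil by (simp, intro sum.union_disjoint) (auto simp: n)
  qed
  also have "(\<Sum>A\<in>insert n ` Pow {1..m}. falling_factorial m (card A)) =
      (\<Sum>A\<in>Pow {1..m}. falling_factorial m (Suc (card A)))"
  proof (subst sum.reindex)
    have "n \<notin> A" if "A \<in> Pow {1..m}" for A using that by (auto simp: n)
    then show "inj_on (insert n) (Pow {1..m})" by (meson inj_onI insert_ident)
    show "sum ((\<lambda>A. falling_factorial m (card A)) \<circ> insert n) (Pow {1..m}) =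
        (\<Sum>A\<in>Pow {1..m}. falling_factorial m (Suc (card A)))"
    proof (rule sum.cong)
      fix A assume "A \<in> Pow {1..m}"
      then have "finite A" "n \<notin> A" by (auto simp: n intro: finite_subset)
      then show "((\<lambda>A. falling_factorial m (card A)) \<circ> insert n) A = falling_factorial m (Suc (card A))" by simp
    qed simp
  qed
  finally have first: "card (nilpotents n) = card (sym_inv_semigroup m) + total_chains m"
    by (simp add: inv total falling_factorial_Suc)

  \<comment> \<open>(2): apply Pascal's rule to every domain, then delete a point of the domain.\<close>
  have "card (sym_inv_semigroup n) =
      (\<Sum>A\<in>Pow {1..n}. falling_factorial m (card A)) +
      (\<Sum>A\<in>Pow {1..n}. card A * falling_factorial m (card A - 1))"
    by (simp only: inv) (simp add: n falling_factorial_Pascal sum.distrib)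
  also have "\<dots> = card (nilpotents n) + total_chains_nilpotent n"
    using sum_Pow_delete_point[of "{1..n}" "falling_factorial m"] by (simp add: nil total_nil mult.commute)
  finally show ?thesis using first n by simp
qed

end
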